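(* Let $d\ge 2$ and let $\tau$ be the identity ordering $\tau(t)=t$ (each task seen once, $T=k$). There is an absolute constant $C>0$ such that for every $k\ge 2$, $$1-\sup_{S\in\mathcal{S}_{T=k}}F_{\tau,S}(k)\le \frac{C}{\sqrt{k}}.$$ In particular, for every $\epsilon\in(0,1)$ there is a task collection of $k=O(1/\epsilon^2)$ tasks with $F_{\tau,S}(k)>1-\epsilon$.
   Context: Let $d\ge 1$, $T\ge1$. A task is a pair $(X_m,y_m)$ with $X_m\in\mathbb{R}^{n_m\times d}$, $y_m\in\mathbb{R}^{n_m}$ and $\operatorname{rank}(X_m)<d$. $\mathcal{S}_T$ denotes the set of collections $S=\{(X_m,y_m)\}_{m=1}^T$ of $T$ tasks such that $\|X_m\|\le 1$ (spectral norm) for all $m$ and there exists $w\in\mathbb{R}^d$ with $\|w\|\le 1$ and $y_m=X_mw$ for all $m$. A task ordering is a map $\tau:\mathbb{N}^+\to\{1,\dots,T\}$. Given $S$ and $\tau$, the iterates are $w_0=0$ and $w_t=w_{t-1}+X_{\tau(t)}^+(y_{\tau(t)}-X_{\tau(t)}w_{t-1})$ for $t\ge1$, where $A^+$ is the Moore–Penrose pseudoinverse. The forgetting at iteration $k$ is $F_{\tau,S}(k)=\frac1k\sum_{t=1}^k\|X_{\tau(t)}w_k-y_{\tau(t)}\|^2$. *)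

theory Defs
  imports "Jordan_Normal_Form.DL_Rank"
begin

definition vnorm :: "real vec \<Rightarrow> real" where
  "vnorm v = sqrt (v \<bullet> v)"

definition spec_norm :: "real mat \<Rightarrow> real" where
  "spec_norm X = Sup {vnorm (X *\<^sub>v x) | x. x \<in> carrier_vec (dim_col X) \<and> vnorm x \<le> 1}"

definition pinv :: "real mat \<Rightarrow> real mat" where
  "pinv X = (THE P. P \<in> carrier_mat (dim_col X) (dim_row X) \<and>
      X * P * X = X \<and> P * X * P = P \<and>
      transpose_mat (X * P) = X * P \<and> transpose_mat (P * X) = P * X)"

definition mrank :: "real mat \<Rightarrow> nat" where
  "mrank X = vec_space.rank (dim_row X) (X :: real mat)"

definition valid_collection ::
    "nat \<Rightarrow> nat \<Rightarrow> (nat \<Rightarrow> real mat) \<Rightarrow> (nat \<Rightarrow> real vec) \<Rightarrow> bool" where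
  "valid_collection d T Xs ys \<longleftrightarrow>
     (\<forall>m\<in>{1..T}. dim_col (Xs m) = d \<and> dim_vec (ys m) = dim_row (Xs m) \<and>
                 mrank (Xs m) < d \<and> spec_norm (Xs m) \<le> 1) \<and>
     (\<exists>w \<in> carrier_vec d. vnorm w \<le> 1 \<and> (\<forall>m\<in>{1..T}. ys m = Xs m *\<^sub>v w))"

fun iterate ::
    "nat \<Rightarrow> (nat \<Rightarrow> real mat) \<Rightarrow> (nat \<Rightarrow> real vec) \<Rightarrow> (nat \<Rightarrow> nat) \<Rightarrow> nat \<Rightarrow> real vec" where
  "iterate d Xs ys tau 0 = 0\<^sub>v d"
| "iterate d Xs ys tau (Suc t) =
     iterate d Xs ys tau t +
     pinv (Xs (tau (Suc t))) *\<^sub>v (ys (tau (Suc t)) - Xs (tau (Suc t)) *\<^sub>v iterate d Xs ys tau t)"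

definition forgetting ::
    "nat \<Rightarrow> (nat \<Rightarrow> real mat) \<Rightarrow> (nat \<Rightarrow> real vec) \<Rightarrow> (nat \<Rightarrow> nat) \<Rightarrow> nat \<Rightarrow> real" where
  "forgetting d Xs ys tau k =
     (1 / real k) * (\<Sum>t\<in>{1..k}. (vnorm (Xs (tau t) *\<^sub>v iterate d Xs ys tau k - ys (tau t)))\<^sup>2)"

end

theory Submission
  imports Defs "HOL-Analysis.L2_Norm"
begin

text \<open>
  Each step replaces the error \<open>w\<^sub>t - w\<close> by its orthogonal projection onto the kernel of the current
  task matrix. The first \<open>k - m\<close> tasks are all the same row, whose kernel contains the
  initial error, so they leave it unchanged. The kernels of the last \<open>m\<close> tasks, taken within a fixed
  plane, rotate by \<open>\<pi>/(2m)\<close> at a time. The final error is then orthogonal to the initial one,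
  that is, worst possible for the first \<open>k - m\<close> tasks, and its norm is \<open>cos (\<pi>/(2m)) ^ m\<close>, whose
  square is at least \<open>1 - 4/m\<close>. Hence the forgetting is at least \<open>1 - m/k - 4/m\<close>, and
  \<open>m \<approx> \<surd>k\<close> gives the rate.

  A supremum of reals is meaningful only for a bounded set, so one also needs that the
  forgetting is at most \<open>1\<close>. This holds because the error norm never increases, but it requires
  that the Moore--Penrose inverse of an arbitrary real matrix exists (otherwise the
  \<open>THE\<close> in its definition is unspecified).
\<close>

section \<open>Existence of the Moore--Penrose inverse\<close>

lemma mult_mat_assoc:
  fixes A B C :: "'a :: semiring_0 mat"
  assumes "dim_col A = dim_row B" "dim_col B = dim_row C"
  shows "A * B * C = A * (B * C)"
  using assms assoc_mult_mat[of A "dim_row A" "dim_row B" B "dim_row C" C "dim_col C"]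
  by (metis carrier_matI)

lemma mult_mat_add_distrib:
  fixes A B C :: "'a :: semiring_0 mat"
  assumes "dim_col A = dim_row B" "dim_row B = dim_row C" "dim_col B = dim_col C"
  shows "A * (B + C) = A * B + A * C"
  using assms mult_add_distrib_mat[of A "dim_row A" "dim_row B" B "dim_col C" C]
  by (metis carrier_matI)

lemma add_mult_mat_distrib:
  fixes A B C :: "'a :: semiring_0 mat"
  assumes "dim_col A = dim_row C" "dim_row A = dim_row B" "dim_col A = dim_col B"
  shows "(A + B) * C = A * C + B * C"
  using assms add_mult_distrib_mat[of A "dim_row A" "dim_row C" B C "dim_col C"]
  by (metis carrier_matI)

lemma mult_mat_diff_distrib:
  fixes A B C :: "'a :: ring mat"
  assumes "dim_col A = dim_row B" "dim_row B = dim_row C" "dim_col B = dim_col C"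
  shows "A * (B - C) = A * B - A * C"
  using assms mult_minus_distrib_mat[of A "dim_row A" "dim_row B" B "dim_col C" C]
  by (metis carrier_matI)

lemma diff_mult_mat_distrib:
  fixes A B C :: "'a :: ring mat"
  assumes "dim_col A = dim_row C" "dim_row A = dim_row B" "dim_col A = dim_col B"
  shows "(A - B) * C = A * C - B * C"
  using assms minus_mult_distrib_mat[of A "dim_row A" "dim_row C" B C "dim_col C"]
  by (metis carrier_matI)

lemma transpose_mult_mat:
  fixes A B :: "'a :: comm_semiring_0 mat"
  assumes "dim_col A = dim_row B"
  shows "(A * B)\<^sup>T = B\<^sup>T * A\<^sup>T"
  using assms transpose_mult[of A "dim_row A" "dim_row B" B "dim_col B"]
  by (metis carrier_matI)

lemma mat_diff_eq_0_iff:
  fixes A B :: "'a :: group_add mat"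
  assumes "dim_row A = dim_row B" "dim_col A = dim_col B"
  shows "A - B = 0\<^sub>m (dim_row A) (dim_col A) \<longleftrightarrow> A = B"
  using assms by (auto simp: mat_eq_iff)

lemmas mat_dims = mult_mat_assoc mult_mat_add_distrib add_mult_mat_distrib
  mult_mat_diff_distrib diff_mult_mat_distrib

text \<open>
  Filling in the zero column \<open>e\<close> of \<open>B\<close> with \<open>a\<close>: if \<open>a\<close> is in the range of \<open>B\<close>, then \<open>H\<close> without
  its row \<open>f\<close> still works; otherwise a functional \<open>z\<close> that kills the range of \<open>B\<close> and
  maps \<open>a\<close> to \<open>1\<close> reads off the new coordinate.
\<close>

lemma inner_inverse_rank_one_update:
  fixes B H a f e :: "'a :: field mat"
  assumes B: "B \<in> carrier_mat n m" and H: "H \<in> carrier_mat m n" and BHB: "B * H * B = B"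
    and a: "a \<in> carrier_mat n 1" and f: "f \<in> carrier_mat 1 m" and e: "e \<in> carrier_mat m 1"
    and Be: "B * e = 0\<^sub>m n 1" and fe: "f * e = 1\<^sub>m 1"
  shows "\<exists>G\<in>carrier_mat m n. (B + a * f) * G * (B + a * f) = B + a * f"
proof -
  note dims = carrier_matD[OF B] carrier_matD[OF H] carrier_matD[OF a] carrier_matD[OF f] carrier_matD[OF e]
  \<comment> \<open>The subtracted term makes \<open>f * H'\<close> zero because
    \<open>f * e\<close> is the identity, and leaves \<open>B * H\<close> unchanged because
    \<open>B * e\<close> is zero.\<close>
  define H' where "H' = H - e * (f * H)"
  have H': "H' \<in> carrier_mat m n" unfolding H'_def by (intro carrier_matI) (simp_all add: dims)
  note dims = dims carrier_matD[OF H']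
  have "B * H' = B * H - (B * e) * (f * H)"
    unfolding H'_def by (simp add: mat_dims dims del: index_mult_mat(1))
  then have BH': "B * H' = B * H" unfolding Be using B H f by (auto simp: mat_eq_iff)
  have "f * H' = f * H - (f * e) * (f * H)"
    unfolding H'_def by (simp add: mat_dims dims del: index_mult_mat(1))
  then have fH': "f * H' = 0\<^sub>m 1 n" unfolding fe using H f by (auto simp: mat_eq_iff)
  have upH': "(B + a * f) * H' = B * H"
    using B H a by (simp add: mat_dims dims BH' fH' del: index_mult_mat(1))
  \<comment> \<open>\<open>B * H\<close> fixes the range of \<open>B\<close>, so \<open>r\<close>
    vanishes exactly when \<open>a\<close> lies in that range.\<close>
  define r where "r = a - B * (H * a)"
  show ?thesis
  proof (cases "r = 0\<^sub>m n 1")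
    case True
    then have a_eq: "a = B * (H * a)"
      using mat_diff_eq_0_iff[of a "B * (H * a)"] unfolding r_def by (simp add: dims)
    have "(B + a * f) * H' * (B + a * f) = B * H * B + (B * (H * a)) * f"
      unfolding upH' by (simp add: mat_dims dims del: index_mult_mat(1))
    then show ?thesis using a_eq BHB H' by auto
  next
    case False
    have r: "r \<in> carrier_mat n 1" unfolding r_def by (intro carrier_matI) (simp_all add: dims)
    then obtain i where i: "i < n" "r $$ (i, 0) \<noteq> 0" using False by (auto simp: mat_eq_iff)
    \<comment> \<open>\<open>s\<close> reads off a nonzero entry of \<open>r\<close>, scaled to 1.
      Its correction \<open>z\<close> vanishes on \<open>B\<close> because
      \<open>B * H * B = B\<close>, and \<open>z * a = s * r\<close>.\<close>
    define s where "s = mat 1 n (\<lambda>(_, j). if j = i then 1 / r $$ (i, 0) else 0)"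
    have s: "s \<in> carrier_mat 1 n" unfolding s_def by simp
    have sr: "s * r = 1\<^sub>m 1"
      using r i unfolding s_def
      by (intro eq_matI) (auto simp: scalar_prod_def if_distrib if_distribR cong: if_cong)
    define z where "z = s - s * (B * H)"
    have z: "z \<in> carrier_mat 1 n" unfolding z_def by (intro carrier_matI) (simp_all add: dims carrier_matD[OF s])
    note dims = dims carrier_matD[OF s] carrier_matD[OF z] carrier_matD[OF r]
    have "z * B = s * B - s * (B * H * B)"
      unfolding z_def by (simp add: mat_dims dims del: index_mult_mat(1))
    then have zB: "z * B = 0\<^sub>m 1 m" unfolding BHB using s B by simp
    have "z * a = s * r"
      unfolding z_def r_def by (simp add: mat_dims dims del: index_mult_mat(1))
    then have za: "z * a = 1\<^sub>m 1" using sr by simp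
    \<comment> \<open>\<open>e - H' * a\<close> is a preimage of \<open>r\<close> under
      \<open>B + a * f\<close>, so \<open>(B + a * f) * G = B * H + r * z\<close>; the second term
      restores the part of \<open>a * f\<close> that \<open>B * H\<close> loses.\<close>
    define G where "G = H' + (e - H' * a) * z"
    have G: "G \<in> carrier_mat m n" unfolding G_def by (intro carrier_matI) (simp_all add: dims)
    have ae: "(B + a * f) * (e - H' * a) = r"
    proof -
      have "(B + a * f) * (e - H' * a) = B * e + a * (f * e) - ((B + a * f) * H') * a"
        by (simp add: mat_dims dims del: index_mult_mat(1))
      also have "\<dots> = a - B * (H * a)"
        unfolding upH' Be fe using a by (simp add: mat_dims dims del: index_mult_mat(1))
      finally show ?thesis unfolding r_def .
    qed
    have "(B + a * f) * G = (B + a * f) * H' + ((B + a * f) * (e - H' * a)) * z"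
      unfolding G_def by (simp add: mat_dims dims del: index_mult_mat(1))
    then have upG: "(B + a * f) * G = B * H + r * z" unfolding upH' ae .
    have "(B + a * f) * G * (B + a * f) = B * H * (B + a * f) + r * z * (B + a * f)"
      unfolding upG by (rule add_mult_mat_distrib) (simp_all add: dims)
    also have "\<dots> = (B * H * B + (B * (H * a)) * f) + r * (z * B + (z * a) * f)"
      by (simp add: mat_dims dims del: index_mult_mat(1))
    also have "\<dots> = (B + (B * (H * a)) * f) + r * f"
      unfolding zB za BHB using f by simp
    also have "\<dots> = (B + (B * (H * a)) * f) + (a * f - (B * (H * a)) * f)"
      unfolding r_def by (simp add: mat_dims dims del: index_mult_mat(1))
    also have "\<dots> = B + a * f"
      by (intro eq_matI) (simp_all add: dims del: index_mult_mat(1))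
    finally show ?thesis using G by blast
  qed
qed

text \<open>Columns are switched on one by one: \<open>T j\<close> keeps those with index below
  \<open>j\<close>, and passing to \<open>T (Suc j)\<close> is a rank-one update that fills a zero
  column.\<close>

lemma inner_inverse_exists:
  fixes A :: "'a :: field mat"
  assumes A: "A \<in> carrier_mat n m"
  shows "\<exists>G\<in>carrier_mat m n. A * G * A = A"
proof -
  define T where "T j = mat n m (\<lambda>(r, c). if c < j then A $$ (r, c) else 0)" for j
  have T: "T j \<in> carrier_mat n m" for j unfolding T_def by simp
  have "\<exists>G\<in>carrier_mat m n. T j * G * T j = T j" if "j \<le> m" for j
    using that
  proof (induction j)
    case 0
    have "T 0 = 0\<^sub>m n m" unfolding T_def by (auto simp: mat_eq_iff)
    then show ?case by (intro bexI[of _ "0\<^sub>m m n"]) simp_all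
  next
    case (Suc j)
    then have j: "j < m" by simp
    obtain H where H: "H \<in> carrier_mat m n" "T j * H * T j = T j" using Suc by auto
    define a where "a = mat n 1 (\<lambda>(r, _). A $$ (r, j))"
    define f where "f = mat 1 m (\<lambda>(_, c). if c = j then 1 else 0 :: 'a)"
    define e where "e = mat m 1 (\<lambda>(c, _). if c = j then 1 else 0 :: 'a)"
    have "T j * e = 0\<^sub>m n 1"
      using j unfolding T_def e_def
      by (intro eq_matI) (auto simp: scalar_prod_def if_distrib if_distribR cong: if_cong)
    moreover have "f * e = 1\<^sub>m 1"
      using j unfolding f_def e_def
      by (intro eq_matI) (auto simp: scalar_prod_def if_distrib if_distribR cong: if_cong)
    moreover have "T (Suc j) = T j + a * f"
      using j unfolding T_def a_def f_def
      by (intro eq_matI) (auto simp: scalar_prod_def less_Suc_eq)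
    ultimately show ?case
      using inner_inverse_rank_one_update[OF T[of j] H, of a f e]
      unfolding a_def f_def e_def by auto
  qed
  moreover have "T m = A" using A unfolding T_def by (auto simp: mat_eq_iff)
  ultimately show ?thesis by force
qed

section \<open>From inner inverses to the Moore-Penrose inverse\<close>

lemma transpose_mult_self_eq_0:
  fixes Z :: "real mat"
  assumes "Z\<^sup>T * Z = 0\<^sub>m (dim_col Z) (dim_col Z)"
  shows "Z = 0\<^sub>m (dim_row Z) (dim_col Z)"
proof (rule eq_matI)
  fix i j assume ij: "i < dim_row (0\<^sub>m (dim_row Z) (dim_col Z) :: real mat)"
    "j < dim_col (0\<^sub>m (dim_row Z) (dim_col Z) :: real mat)"
  then have "(Z\<^sup>T * Z) $$ (j, j) = 0" using assms by simp
  then have "(\<Sum>k\<in>{0..<dim_row Z}. Z $$ (k, j) * Z $$ (k, j)) = 0"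
    using ij by (simp add: scalar_prod_def)
  then show "Z $$ (i, j) = 0\<^sub>m (dim_row Z) (dim_col Z) $$ (i, j)"
    using ij by (subst (asm) sum_nonneg_eq_0_iff) auto
qed simp_all

text \<open>The residual \<open>?Z\<close> is a multiple \<open>X * Y\<close> and is killed by
  \<open>X\<^sup>T\<close>, so \<open>?Z\<^sup>T * ?Z\<close> vanishes; over the reals this forces
  \<open>?Z\<close> to vanish.\<close>

lemma gram_inner_inverse:
  fixes X :: "real mat"
  assumes X: "X \<in> carrier_mat n d" and G: "G \<in> carrier_mat d d"
    and AGA: "X\<^sup>T * X * G * (X\<^sup>T * X) = X\<^sup>T * X"
  shows "X * G * (X\<^sup>T * X) = X"
proof -
  note dims = carrier_matD[OF X] carrier_matD[OF G]
  let ?Z = "X * G * (X\<^sup>T * X) - X"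
  have 0: "X\<^sup>T * ?Z = 0\<^sub>m d d"
    using AGA X by (simp add: mat_dims dims del: index_mult_mat(1))
  have "?Z\<^sup>T * ?Z = (X * (G * (X\<^sup>T * X) - 1\<^sub>m d))\<^sup>T * ?Z"
    using X by (simp add: mat_dims dims del: index_mult_mat(1))
  also have "\<dots> = (G * (X\<^sup>T * X) - 1\<^sub>m d)\<^sup>T * (X\<^sup>T * ?Z)"
    using dims by (subst transpose_mult_mat) (simp_all add: mult_mat_assoc)
  also have "\<dots> = 0\<^sub>m d d"
    unfolding 0 by (intro right_mult_zero_mat[of _ _ d] carrier_matI) (simp_all add: dims)
  finally have "?Z\<^sup>T * ?Z = 0\<^sub>m d d" .
  then have "?Z = 0\<^sub>m n d"
    using transpose_mult_self_eq_0[of ?Z] dims by simp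
  then show ?thesis
    using mat_diff_eq_0_iff[of "X * G * (X\<^sup>T * X)" X] dims by simp
qed

text \<open>The witness is \<open>G * X\<^sup>T\<close> for an inner inverse \<open>G\<close> of the
  Gram matrix. \<open>G\<close> may fail to be symmetric, so the symmetry of
  \<open>X * G * X\<^sup>T\<close> has to be derived.\<close>

lemma least_squares_inverse_exists:
  fixes X :: "real mat"
  assumes X: "X \<in> carrier_mat n d"
  shows "\<exists>L\<in>carrier_mat d n. X * L * X = X \<and> (X * L)\<^sup>T = X * L"
proof -
  have A: "X\<^sup>T * X \<in> carrier_mat d d" using X by simp
  obtain G where G: "G \<in> carrier_mat d d" and AGA: "X\<^sup>T * X * G * (X\<^sup>T * X) = X\<^sup>T * X"
    using inner_inverse_exists[OF A] by blast
  note dims = carrier_matD[OF X] carrier_matD[OF G]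
  have "(X\<^sup>T * X * G * (X\<^sup>T * X))\<^sup>T = (X\<^sup>T * X)\<^sup>T" using AGA by simp
  then have AGA': "X\<^sup>T * X * G\<^sup>T * (X\<^sup>T * X) = X\<^sup>T * X"
    by (simp add: transpose_mult_mat mult_mat_assoc dims)
  have 1: "X * G * (X\<^sup>T * X) = X" by (rule gram_inner_inverse[OF X G AGA])
  have 2: "X * G\<^sup>T * (X\<^sup>T * X) = X"
    using gram_inner_inverse[OF X _ AGA'] G by simp
  \<comment> \<open>Since \<open>G\<^sup>T\<close> is an inner inverse too, the matrix equals its
    own transpose times itself, which is visibly symmetric.\<close>
  have "X * G * X\<^sup>T = (X * G\<^sup>T * (X\<^sup>T * X)) * G * X\<^sup>T" using 2 by simp
  also have "\<dots> = (X * G\<^sup>T * X\<^sup>T) * (X * G * X\<^sup>T)" by (simp add: mult_mat_assoc dims)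
  finally have 3: "X * G * X\<^sup>T = (X * G\<^sup>T * X\<^sup>T) * (X * G * X\<^sup>T)" .
  have 4: "(X * G * X\<^sup>T)\<^sup>T = X * G\<^sup>T * X\<^sup>T" by (simp add: transpose_mult_mat mult_mat_assoc dims)
  have 5: "((X * G\<^sup>T * X\<^sup>T) * (X * G * X\<^sup>T))\<^sup>T = (X * G\<^sup>T * X\<^sup>T) * (X * G * X\<^sup>T)"
    by (simp add: transpose_mult_mat mult_mat_assoc dims)
  have "(X * G * X\<^sup>T)\<^sup>T = X * G * X\<^sup>T" using 3 5 by metis
  then show ?thesis
    using X G 1 by (intro bexI[of _ "G * X\<^sup>T"]) (simp_all add: mult_mat_assoc dims)
qed

text \<open>The predicate under \<open>THE\<close> in \<open>pinv\<close>, named so that existence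
  and uniqueness can be treated separately.\<close>

definition penrose :: "real mat \<Rightarrow> real mat \<Rightarrow> bool" where
  "penrose X P \<longleftrightarrow> P \<in> carrier_mat (dim_col X) (dim_row X) \<and>
      X * P * X = X \<and> P * X * P = P \<and> (X * P)\<^sup>T = X * P \<and> (P * X)\<^sup>T = P * X"

text \<open>\<open>L\<close> makes \<open>X * L\<close> symmetric, and \<open>M\<close>, obtained
  from the transpose of \<open>X\<close>, makes \<open>M * X\<close> symmetric.
  \<open>P = M * X * L\<close> inherits both, as \<open>X * P = X * L\<close> and
  \<open>P * X = M * X\<close>.\<close>

lemma penrose_exists: "\<exists>P. penrose X P"
proof -
  define n d where nd: "n = dim_row X" "d = dim_col X"
  have X: "X \<in> carrier_mat n d" unfolding nd by simp
  obtain L where L: "L \<in> carrier_mat d n" "X * L * X = X" "(X * L)\<^sup>T = X * L"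
    using least_squares_inverse_exists[OF X] by blast
  have "X\<^sup>T \<in> carrier_mat d n" using X by simp
  then obtain R where R: "R \<in> carrier_mat n d" "X\<^sup>T * R * X\<^sup>T = X\<^sup>T" "(X\<^sup>T * R)\<^sup>T = X\<^sup>T * R"
    using least_squares_inverse_exists by blast
  define M where "M = R\<^sup>T"
  have M: "M \<in> carrier_mat d n" using R unfolding M_def by simp
  note dims = carrier_matD[OF X] carrier_matD[OF L(1)] carrier_matD[OF R(1)] carrier_matD[OF M]
  have MX: "M * X = X\<^sup>T * R" using R(3) unfolding M_def by (simp add: transpose_mult_mat dims)
  then have MXs: "(M * X)\<^sup>T = M * X" using R(3) by simp
  have "(X\<^sup>T * R * X\<^sup>T)\<^sup>T = X" using R(2) by simp
  then have XMX: "X * M * X = X" unfolding M_def by (simp add: transpose_mult_mat mult_mat_assoc dims)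
  define P where "P = M * X * L"
  have P: "P \<in> carrier_mat d n" unfolding P_def using M X L by simp
  have "X * P = (X * M * X) * L" unfolding P_def by (simp add: mult_mat_assoc dims)
  then have XP: "X * P = X * L" unfolding XMX .
  have "P * X = M * (X * L * X)" unfolding P_def by (simp add: mult_mat_assoc dims)
  then have PX: "P * X = M * X" unfolding L(2) .
  have "P * X * P = M * (X * M * X) * L" unfolding PX unfolding P_def by (simp add: mult_mat_assoc dims)
  then have PXP: "P * X * P = P" unfolding XMX P_def .
  show ?thesis
    unfolding penrose_def using P XP PX PXP L MXs nd by auto
qed

text \<open>\<open>X * P\<close> and \<open>X * Q\<close> are symmetric idempotents with the same
  range, hence equal; \<open>P * X\<close> and \<open>Q * X\<close> are so with the same kernel.
  These products determine \<open>P = P * X * P\<close>.\<close>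

lemma penrose_unique:
  assumes "penrose X P" "penrose X Q"
  shows "P = Q"
proof -
  have dims: "dim_row P = dim_col X" "dim_col P = dim_row X" "dim_row Q = dim_col X" "dim_col Q = dim_row X"
    using assms unfolding penrose_def by auto
  have P: "X * P * X = X" "P * X * P = P" "(X * P)\<^sup>T = X * P" "(P * X)\<^sup>T = P * X"
    and Q: "X * Q * X = X" "Q * X * Q = Q" "(X * Q)\<^sup>T = X * Q" "(Q * X)\<^sup>T = Q * X"
    using assms unfolding penrose_def by auto
  have "X * P = (X * Q * X) * P" using Q by simp
  also have "\<dots> = (X * Q) * (X * P)" by (simp add: mult_mat_assoc dims)
  also have "\<dots> = ((X * P) * (X * Q))\<^sup>T" using P Q dims by (subst transpose_mult_mat) simp_all
  also have "(X * P) * (X * Q) = (X * P * X) * Q" by (simp add: mult_mat_assoc dims)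
  finally have XP: "X * P = X * Q" using P Q by simp
  have "P * X = P * (X * Q * X)" using Q by simp
  also have "\<dots> = (P * X) * (Q * X)" by (simp add: mult_mat_assoc dims)
  also have "\<dots> = ((Q * X) * (P * X))\<^sup>T" using P Q dims by (subst transpose_mult_mat) simp_all
  also have "(Q * X) * (P * X) = Q * (X * P * X)" by (simp add: mult_mat_assoc dims)
  finally have PX: "P * X = Q * X" using P Q by simp
  have "P = (P * X) * P" using P by simp
  also have "\<dots> = Q * (X * P)" unfolding PX by (simp add: mult_mat_assoc dims)
  also have "\<dots> = Q * X * Q" unfolding XP by (simp add: mult_mat_assoc dims)
  finally show ?thesis using Q by simp
qed

lemma pinv_eqI: "penrose X P \<Longrightarrow> pinv X = P"
  unfolding pinv_def penrose_def[symmetric] by (blast intro: penrose_unique)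

lemma penrose_pinv: "penrose X (pinv X)"
  using penrose_exists pinv_eqI by metis

section \<open>Forgetting is bounded\<close>

lemma scalar_prod_self_nonneg: "0 \<le> v \<bullet> (v :: real vec)"
  unfolding scalar_prod_def by (rule sum_nonneg) simp

lemma vnorm_nonneg: "0 \<le> vnorm v"
  unfolding vnorm_def by (simp add: scalar_prod_self_nonneg)

lemma vnorm_smult: "vnorm (c \<cdot>\<^sub>v v) = \<bar>c\<bar> * vnorm v"
proof -
  have "(c \<cdot>\<^sub>v v) \<bullet> (c \<cdot>\<^sub>v v) = c\<^sup>2 * (v \<bullet> v)"
    by (simp add: power2_eq_square)
  then show ?thesis unfolding vnorm_def by (simp add: real_sqrt_mult)
qed

lemma vnorm_eq_0D:
  assumes "v \<in> carrier_vec n" "vnorm v = 0"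
  shows "v = 0\<^sub>v n"
proof -
  have "(\<Sum>i\<in>{0..<n}. v $ i * v $ i) = 0"
    using assms by (simp add: vnorm_def scalar_prod_def)
  then show ?thesis
    using assms(1) by (subst (asm) sum_nonneg_eq_0_iff) (auto intro!: eq_vecI)
qed

lemma scalar_prod_le_vnorm:
  assumes "dim_vec u = dim_vec v"
  shows "\<bar>u \<bullet> v\<bar> \<le> vnorm u * vnorm v"
proof -
  let ?I = "{0..<dim_vec v}"
  have "\<bar>u \<bullet> v\<bar> \<le> (\<Sum>i\<in>?I. \<bar>u $ i\<bar> * \<bar>v $ i\<bar>)"
    unfolding scalar_prod_def abs_mult[symmetric] by (rule sum_abs)
  also have "\<dots> \<le> L2_set (($) u) ?I * L2_set (($) v) ?I" by (rule L2_set_mult_ineq)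
  also have "\<dots> = vnorm u * vnorm v"
    unfolding L2_set_def vnorm_def scalar_prod_def using assms by (simp add: power2_eq_square)
  finally show ?thesis .
qed

text \<open>The \<open>Sup\<close> in \<open>spec_norm\<close> is meaningful only for a bounded set;
  Cauchy-Schwarz on each row gives the Frobenius norm as a bound.\<close>

lemma spec_norm_bdd:
  "bdd_above {vnorm (X *\<^sub>v x) | x. x \<in> carrier_vec (dim_col X) \<and> vnorm x \<le> 1}"
proof (rule bdd_aboveI, clarify)
  fix x assume x: "x \<in> carrier_vec (dim_col X)" "vnorm x \<le> 1"
  have "(X *\<^sub>v x) \<bullet> (X *\<^sub>v x) = (\<Sum>i\<in>{0..<dim_row X}. (row X i \<bullet> x)\<^sup>2)"
    by (simp add: scalar_prod_def[of "X *\<^sub>v x"] power2_eq_square)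
  also have "\<dots> \<le> (\<Sum>i\<in>{0..<dim_row X}. (vnorm (row X i))\<^sup>2)"
  proof (rule sum_mono)
    fix i
    have "\<bar>row X i \<bullet> x\<bar> \<le> vnorm (row X i) * vnorm x"
      using x by (intro scalar_prod_le_vnorm) simp
    also have "\<dots> \<le> vnorm (row X i)"
      using mult_left_mono[OF x(2) vnorm_nonneg] by simp
    finally show "(row X i \<bullet> x)\<^sup>2 \<le> (vnorm (row X i))\<^sup>2"
      using power_mono[of "\<bar>row X i \<bullet> x\<bar>" _ 2] by simp
  qed
  finally show "vnorm (X *\<^sub>v x) \<le> sqrt (\<Sum>i\<in>{0..<dim_row X}. (vnorm (row X i))\<^sup>2)"
    unfolding vnorm_def[of "X *\<^sub>v x"] by simp
qed

text \<open>Scaling \<open>v\<close> to norm 1 puts it into the set under the \<open>Sup\<close>;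
  the zero vector cannot be scaled and is treated apart.\<close>

lemma vnorm_mult_le:
  assumes X: "X \<in> carrier_mat n d" "spec_norm X \<le> 1" and v: "v \<in> carrier_vec d"
  shows "vnorm (X *\<^sub>v v) \<le> vnorm v"
proof (cases "vnorm v = 0")
  case True
  then have "v = 0\<^sub>v d" using v vnorm_eq_0D by blast
  then have "X *\<^sub>v v = 0 \<cdot>\<^sub>v (X *\<^sub>v v)"
    using X by (intro eq_vecI) auto
  then have "vnorm (X *\<^sub>v v) = 0" by (metis vnorm_smult abs_zero mult_zero_left)
  then show ?thesis by (simp add: vnorm_nonneg)
next
  case False
  then have pos: "vnorm v > 0" using vnorm_nonneg[of v] by simp
  define x where "x = (1 / vnorm v) \<cdot>\<^sub>v v"
  have "vnorm (X *\<^sub>v x) \<le> spec_norm X"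
    unfolding spec_norm_def
  proof (rule cSup_upper[OF _ spec_norm_bdd], intro CollectI exI conjI)
    show "x \<in> carrier_vec (dim_col X)" using X v unfolding x_def by simp
    show "vnorm x \<le> 1" using pos unfolding x_def by (simp add: vnorm_smult)
  qed simp
  moreover have "X *\<^sub>v x = (1 / vnorm v) \<cdot>\<^sub>v (X *\<^sub>v v)"
    unfolding x_def using mult_mat_vec[OF X(1) v] by simp
  ultimately have "vnorm (X *\<^sub>v v) / vnorm v \<le> spec_norm X" using pos by (simp add: vnorm_smult)
  then have "vnorm (X *\<^sub>v v) / vnorm v \<le> 1" using X(2) by (rule order_trans)
  then show ?thesis using pos by (simp add: divide_le_eq_1)
qed

text \<open>Symmetry and idempotence give \<open>?q \<bullet> ?q = e \<bullet> ?q\<close>, so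
  Pythagoras applies.\<close>

lemma vnorm_diff_projection_le:
  assumes Q: "Q \<in> carrier_mat d d" "Q\<^sup>T = Q" "Q * Q = Q" and e: "e \<in> carrier_vec d"
  shows "vnorm (e - Q *\<^sub>v e) \<le> vnorm e"
proof -
  let ?q = "Q *\<^sub>v e"
  have q: "?q \<in> carrier_vec d" using Q e by simp
  have "?q \<bullet> ?q = e \<bullet> (Q *\<^sub>v ?q)"
    using transpose_vec_mult_scalar[OF Q(1) q e] Q(2) by simp
  also have "Q *\<^sub>v ?q = ?q"
    using assoc_mult_mat_vec[OF Q(1) Q(1) e] Q(3) by simp
  finally have qq: "?q \<bullet> ?q = e \<bullet> ?q" .
  have "?q \<bullet> e = e \<bullet> ?q" using comm_scalar_prod[OF q e] .
  then have "(e - ?q) \<bullet> (e - ?q) = e \<bullet> e - ?q \<bullet> ?q"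
    using qq e q by (simp add: minus_scalar_prod_distrib[of _ d] scalar_prod_minus_distrib[of _ d])
  then show ?thesis unfolding vnorm_def using scalar_prod_self_nonneg[of ?q] by simp
qed

section \<open>Effect of an update on the error\<close>

lemma pinv_carrier: "X \<in> carrier_mat n d \<Longrightarrow> pinv X \<in> carrier_mat d n"
  using penrose_pinv[of X] unfolding penrose_def by auto

text \<open>With realizable labels a step acts linearly on the error, and only
  \<open>pinv X * X\<close> matters.\<close>

lemma update_error:
  assumes X: "X \<in> carrier_mat n d" and u: "u \<in> carrier_vec d" and w: "w \<in> carrier_vec d"
  shows "u + pinv X *\<^sub>v (X *\<^sub>v w - X *\<^sub>v u) - w = (u - w) - (pinv X * X) *\<^sub>v (u - w)"
proof -
  have P: "pinv X \<in> carrier_mat d n" using X by (rule pinv_carrier)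
  have PX: "pinv X * X \<in> carrier_mat d d" using P X by simp
  have "pinv X *\<^sub>v (X *\<^sub>v w - X *\<^sub>v u) = (pinv X * X) *\<^sub>v w - (pinv X * X) *\<^sub>v u"
    using P X u w by (simp add: mult_minus_distrib_mat_vec[OF P] assoc_mult_mat_vec[OF P X])
  moreover have "(pinv X * X) *\<^sub>v (u - w) = (pinv X * X) *\<^sub>v u - (pinv X * X) *\<^sub>v w"
    by (rule mult_minus_distrib_mat_vec[OF PX u w])
  ultimately show ?thesis
    using u w P X by (intro eq_vecI) (simp_all del: index_mult_mat_vec)
qed

text \<open>By the Penrose equations \<open>pinv X * X\<close> is symmetric and idempotent, so a
  step projects the error orthogonally.\<close>

lemma update_error_le:
  assumes X: "X \<in> carrier_mat n d" and u: "u \<in> carrier_vec d" and w: "w \<in> carrier_vec d"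
  shows "vnorm (u + pinv X *\<^sub>v (X *\<^sub>v w - X *\<^sub>v u) - w) \<le> vnorm (u - w)"
proof -
  have P: "pinv X \<in> carrier_mat d n" using X by (rule pinv_carrier)
  have "pinv X * X * (pinv X * X) = pinv X * X * pinv X * X"
    using P X by (simp add: mult_mat_assoc)
  then have "pinv X * X * (pinv X * X) = pinv X * X"
    using penrose_pinv[of X] unfolding penrose_def by simp
  moreover have "(pinv X * X)\<^sup>T = pinv X * X"
    using penrose_pinv[of X] unfolding penrose_def by simp
  ultimately show ?thesis
    unfolding update_error[OF assms] using P X u w by (intro vnorm_diff_projection_le[of _ d]) simp_all
qed

text \<open>The initial error is \<open>- w\<close>, and no step lengthens it.\<close>

lemma iterate_error_le:
  assumes X: "\<And>m. m \<in> {1..T} \<Longrightarrow> dim_col (Xs m) = d" and w: "w \<in> carrier_vec d"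
    and y: "\<And>m. m \<in> {1..T} \<Longrightarrow> ys m = Xs m *\<^sub>v w"
    and tau: "\<And>s. s \<in> {1..t} \<Longrightarrow> tau s \<in> {1..T}"
  shows "iterate d Xs ys tau t \<in> carrier_vec d \<and> vnorm (iterate d Xs ys tau t - w) \<le> vnorm w"
  using tau
proof (induction t)
  case 0
  have "0\<^sub>v d - w = (-1) \<cdot>\<^sub>v w" using w by (intro eq_vecI) auto
  then show ?case by (simp add: vnorm_smult)
next
  case (Suc t)
  let ?m = "tau (Suc t)" and ?u = "iterate d Xs ys tau t"
  have m: "?m \<in> {1..T}" using Suc.prems by simp
  have Xm: "Xs ?m \<in> carrier_mat (dim_row (Xs ?m)) d" using X[OF m] by auto
  have IH: "?u \<in> carrier_vec d" "vnorm (?u - w) \<le> vnorm w" using Suc by auto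
  have it: "iterate d Xs ys tau (Suc t) = ?u + pinv (Xs ?m) *\<^sub>v (Xs ?m *\<^sub>v w - Xs ?m *\<^sub>v ?u)"
    using y[OF m] by simp
  have "vnorm (iterate d Xs ys tau (Suc t) - w) \<le> vnorm w"
    unfolding it using update_error_le[OF Xm IH(1) w] IH(2) by (rule order_trans)
  moreover have "iterate d Xs ys tau (Suc t) \<in> carrier_vec d"
    unfolding it using IH(1) pinv_carrier[OF Xm] by (intro carrier_vecI) simp
  ultimately show ?case by blast
qed

text \<open>Each residual is the error mapped by a matrix of spectral norm at most 1, and the error
  is no longer than the teacher \<open>w\<close>.\<close>

lemma forgetting_le_1:
  assumes "valid_collection d T Xs ys" "\<And>s. s \<in> {1..k} \<Longrightarrow> tau s \<in> {1..T}"
  shows "forgetting d Xs ys tau k \<le> 1"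
proof -
  obtain w where w: "w \<in> carrier_vec d" "vnorm w \<le> 1" "\<And>m. m \<in> {1..T} \<Longrightarrow> ys m = Xs m *\<^sub>v w"
    using assms(1) unfolding valid_collection_def by blast
  have X: "dim_col (Xs m) = d" "spec_norm (Xs m) \<le> 1" if "m \<in> {1..T}" for m
    using assms(1) that unfolding valid_collection_def by auto
  let ?u = "iterate d Xs ys tau k"
  have u: "?u \<in> carrier_vec d" "vnorm (?u - w) \<le> 1"
    using iterate_error_le[of T Xs d w ys k tau] X w assms(2) by fastforce+
  have "(vnorm (Xs (tau t) *\<^sub>v ?u - ys (tau t)))\<^sup>2 \<le> 1" if t: "t \<in> {1..k}" for t
  proof -
    have m: "tau t \<in> {1..T}" using assms(2) t .
    have Xm: "Xs (tau t) \<in> carrier_mat (dim_row (Xs (tau t))) d" using X(1)[OF m] by auto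
    have "Xs (tau t) *\<^sub>v ?u - ys (tau t) = Xs (tau t) *\<^sub>v (?u - w)"
      using mult_minus_distrib_mat_vec[OF Xm u(1) w(1)] w(3)[OF m] by simp
    then have "vnorm (Xs (tau t) *\<^sub>v ?u - ys (tau t)) \<le> 1"
      using vnorm_mult_le[OF Xm X(2)[OF m], of "?u - w"] u w by simp
    then show ?thesis by (simp add: power_le_one vnorm_nonneg)
  qed
  then have "(\<Sum>t\<in>{1..k}. (vnorm (Xs (tau t) *\<^sub>v ?u - ys (tau t)))\<^sup>2) \<le> real k"
    using sum_bounded_above[of "{1..k}" "\<lambda>t. (vnorm (Xs (tau t) *\<^sub>v ?u - ys (tau t)))\<^sup>2" 1] by simp
  \<comment> \<open>For \<open>k = 0\<close> the factor \<open>1 / real k\<close> is 0 by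
    convention.\<close>
  then show ?thesis unfolding forgetting_def by (cases "k = 0") (simp_all add: divide_le_eq_1)
qed

section \<open>Rotating tasks\<close>

lemma mult_mat_of_row:
  "mat_of_row v *\<^sub>v x = vec 1 (\<lambda>_. v \<bullet> x)"
  by (intro eq_vecI) auto

lemma vnorm_vec_1: "vnorm (vec 1 (\<lambda>_. c)) = \<bar>c\<bar>"
  by (simp add: vnorm_def scalar_prod_def)

text \<open>A unit row times its transpose is the 1 by 1 identity, which collapses the Penrose
  equations.\<close>

lemma pinv_unit_row:
  assumes "v \<bullet> v = 1"
  shows "pinv (mat_of_row v) = (mat_of_row v)\<^sup>T"
proof (rule pinv_eqI)
  let ?X = "mat_of_row v :: real mat"
  have 1: "?X * ?X\<^sup>T = 1\<^sub>m 1" using assms by (intro eq_matI) auto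
  have X: "?X \<in> carrier_mat 1 (dim_vec v)" by (intro carrier_matI) simp_all
  have "?X\<^sup>T * ?X * ?X\<^sup>T = ?X\<^sup>T * (?X * ?X\<^sup>T)" by (simp add: mult_mat_assoc)
  then have "?X\<^sup>T * ?X * ?X\<^sup>T = ?X\<^sup>T" unfolding 1 using X by simp
  moreover have "?X * ?X\<^sup>T * ?X = ?X" unfolding 1 using X by simp
  ultimately show "penrose ?X ?X\<^sup>T"
    unfolding penrose_def by (simp add: transpose_mult_mat del: assoc_mult_mat)
qed

lemma pinv_unit_row_mult:
  assumes v: "v \<in> carrier_vec d" "v \<bullet> v = 1" and e: "e \<in> carrier_vec d"
  shows "(pinv (mat_of_row v) * mat_of_row v) *\<^sub>v e = (v \<bullet> e) \<cdot>\<^sub>v v"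
proof -
  have X: "mat_of_row v \<in> carrier_mat 1 d" using v by simp
  have XT: "(mat_of_row v)\<^sup>T \<in> carrier_mat d 1" using X by simp
  show ?thesis
    unfolding pinv_unit_row[OF v(2)] assoc_mult_mat_vec[OF XT X e] mult_mat_of_row
    using v by (intro eq_vecI) (auto simp: scalar_prod_def mat_of_row_def)
qed

text \<open>A row is the outer product of the scalar 1 with \<open>v\<close>; for
  \<open>d \<ge> 2\<close> this makes the task rank deficient.\<close>

lemma mrank_mat_of_row: "mrank (mat_of_row v) \<le> 1"
  unfolding mrank_def
  by (rule vec_space.rank_le_1_product_entries[of _ _ "dim_vec v" "\<lambda>_. 1" "\<lambda>j. v $ j"])
     (auto simp: mat_of_row_def)

lemma spec_norm_unit_row:
  assumes "v \<bullet> v = 1"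
  shows "spec_norm (mat_of_row v) \<le> 1"
  unfolding spec_norm_def
proof (rule cSup_least)
  show "{vnorm (mat_of_row v *\<^sub>v x) | x. x \<in> carrier_vec (dim_col (mat_of_row v)) \<and> vnorm x \<le> 1} \<noteq> {}"
    by (auto intro!: exI[of _ "0\<^sub>v (dim_vec v)"] simp: vnorm_def)
  fix r assume "r \<in> {vnorm (mat_of_row v *\<^sub>v x) | x. x \<in> carrier_vec (dim_col (mat_of_row v)) \<and> vnorm x \<le> 1}"
  then obtain x where x: "x \<in> carrier_vec (dim_vec v)" "vnorm x \<le> 1" "r = vnorm (mat_of_row v *\<^sub>v x)" by auto
  have "r = \<bar>v \<bullet> x\<bar>" unfolding x mult_mat_of_row by (rule vnorm_vec_1)
  also have "\<dots> \<le> vnorm v * vnorm x" using x by (intro scalar_prod_le_vnorm) simp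
  also have "\<dots> \<le> 1" using x assms by (simp add: vnorm_def)
  finally show "r \<le> 1" .
qed

section \<open>A rotating family in a coordinate plane\<close>

text \<open>Two coordinates carry the whole construction; zero padding transfers it to every
  dimension from 2 on.\<close>

definition plane_vec :: "nat \<Rightarrow> real \<Rightarrow> real \<Rightarrow> real vec" where
  "plane_vec d a b = vec d (\<lambda>i. if i = 0 then a else if i = 1 then b else 0)"

lemma plane_vec_carrier [simp]: "plane_vec d a b \<in> carrier_vec d" "dim_vec (plane_vec d a b) = d"
  unfolding plane_vec_def by simp_all

lemma plane_vec_minus: "plane_vec d a b - plane_vec d a' b' = plane_vec d (a - a') (b - b')"
  unfolding plane_vec_def by (intro eq_vecI) auto

lemma plane_vec_smult: "c \<cdot>\<^sub>v plane_vec d a b = plane_vec d (c * a) (c * b)"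
  unfolding plane_vec_def by (intro eq_vecI) auto

lemma plane_vec_scalar_prod:
  assumes "d \<ge> 2"
  shows "plane_vec d a b \<bullet> plane_vec d a' b' = a * a' + b * b'"
proof -
  obtain n where "d = Suc (Suc n)" using assms by (metis add_2_eq_Suc le_iff_add)
  then show ?thesis
    unfolding plane_vec_def scalar_prod_def
    by (simp add: sum.atLeast0_lessThan_Suc_shift del: sum.op_ivl_Suc)
qed

text \<open>
  Projecting onto the kernel of the row with angle \<open>\<theta>\<close> replaces the error by its component
  along \<open>(cos \<theta>, sin \<theta>)\<close>; the labels come from the teacher \<open>(1, 0)\<close>, so that the initial error
  points in direction \<open>\<theta> = 0\<close>.
\<close>

definition rot_row :: "nat \<Rightarrow> (nat \<Rightarrow> real) \<Rightarrow> nat \<Rightarrow> real mat" where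
  "rot_row d \<theta> t = mat_of_row (plane_vec d (- sin (\<theta> t)) (cos (\<theta> t)))"

definition rot_label :: "nat \<Rightarrow> (nat \<Rightarrow> real) \<Rightarrow> nat \<Rightarrow> real vec" where
  "rot_label d \<theta> t = rot_row d \<theta> t *\<^sub>v plane_vec d 1 0"

lemma rot_row_carrier: "rot_row d \<theta> t \<in> carrier_mat 1 d"
  unfolding rot_row_def by (simp del: One_nat_def)

lemma rot_normal_unit:
  "d \<ge> 2 \<Longrightarrow> plane_vec d (- sin x) (cos x) \<bullet> plane_vec d (- sin x) (cos x) = 1"
  by (simp add: plane_vec_scalar_prod flip: power2_eq_square)

lemma valid_collection_rot:
  assumes "d \<ge> 2"
  shows "valid_collection d k (rot_row d \<theta>) (rot_label d \<theta>)"
  unfolding valid_collection_def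
proof (intro conjI ballI bexI[of _ "plane_vec d 1 0"])
  fix m
  show "mrank (rot_row d \<theta> m) < d"
    using mrank_mat_of_row assms unfolding rot_row_def
    by (metis le_less_trans less_le_trans one_less_numeral_iff semiring_norm(76))
  show "spec_norm (rot_row d \<theta> m) \<le> 1"
    unfolding rot_row_def using assms by (intro spec_norm_unit_row rot_normal_unit)
  show "vnorm (plane_vec d 1 0) \<le> 1"
    using assms by (simp add: vnorm_def plane_vec_scalar_prod)
qed (simp_all add: rot_row_def rot_label_def)

text \<open>Projecting from direction \<open>\<theta> s\<close> onto direction
  \<open>\<theta> (Suc s)\<close> scales the error by the cosine of the gap. Index 0 is not a task:
  \<open>\<theta> 0 = 0\<close> encodes the initial error \<open>plane_vec d (-1) 0\<close>.\<close>

lemma iterate_rot: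
  assumes d: "d \<ge> 2" and "\<theta> 0 = 0"
  defines "p \<equiv> \<lambda>t. \<Prod>s<t. cos (\<theta> (Suc s) - \<theta> s)"
  shows "iterate d (rot_row d \<theta>) (rot_label d \<theta>) id t \<in> carrier_vec d \<and>
    iterate d (rot_row d \<theta>) (rot_label d \<theta>) id t - plane_vec d 1 0 =
      plane_vec d (- p t * cos (\<theta> t)) (- p t * sin (\<theta> t))"
proof (induction t)
  case 0
  have "0\<^sub>v d = plane_vec d 0 0" unfolding plane_vec_def by (intro eq_vecI) auto
  then show ?case using assms(2) by (simp add: plane_vec_minus p_def)
next
  case (Suc t)
  let ?u = "iterate d (rot_row d \<theta>) (rot_label d \<theta>) id t"
  let ?w = "plane_vec d 1 0" and ?X = "rot_row d \<theta> (Suc t)"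
  let ?v = "plane_vec d (- sin (\<theta> (Suc t))) (cos (\<theta> (Suc t)))"
  define x y where xy: "x = \<theta> t" "y = \<theta> (Suc t)"
  have pSuc: "p (Suc t) = p t * cos (y - x)" by (simp add: p_def xy)
  have X: "?X \<in> carrier_mat 1 d" by (rule rot_row_carrier)
  have IH: "?u \<in> carrier_vec d" "?u - ?w = plane_vec d (- p t * cos x) (- p t * sin x)"
    using Suc unfolding xy by blast+
  have it: "iterate d (rot_row d \<theta>) (rot_label d \<theta>) id (Suc t) = ?u + pinv ?X *\<^sub>v (?X *\<^sub>v ?w - ?X *\<^sub>v ?u)"
    by (simp add: rot_label_def)
  have "(pinv ?X * ?X) *\<^sub>v (?u - ?w) = (?v \<bullet> (?u - ?w)) \<cdot>\<^sub>v ?v"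
    unfolding rot_row_def[of d \<theta> "Suc t"]
    using IH(1) by (intro pinv_unit_row_mult[of _ d] rot_normal_unit d) simp_all
  then have "iterate d (rot_row d \<theta>) (rot_label d \<theta>) id (Suc t) - ?w = (?u - ?w) - (?v \<bullet> (?u - ?w)) \<cdot>\<^sub>v ?v"
    unfolding it using update_error[OF X IH(1), of ?w] by simp
  also have "\<dots> = plane_vec d (- p t * cos x + p t * sin (y - x) * sin y)
      (- p t * sin x - p t * sin (y - x) * cos y)"
    unfolding IH(2) plane_vec_scalar_prod[OF d] plane_vec_smult plane_vec_minus xy sin_diff
    by (simp add: algebra_simps)
  \<comment> \<open>Writing the old angle as \<open>y - (y - x)\<close> leaves only the new angle
    and the gap; the terms in \<open>sin (y - x)\<close> cancel.\<close>
  also have "- p t * cos x + p t * sin (y - x) * sin y = - (p t * cos (y - x)) * cos y"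
  proof -
    have "cos x = cos (y - (y - x))" by simp
    also have "\<dots> = cos y * cos (y - x) + sin y * sin (y - x)" by (rule cos_diff)
    finally have *: "cos x = cos y * cos (y - x) + sin y * sin (y - x)" .
    show ?thesis by (subst *) (simp add: algebra_simps)
  qed
  also have "- p t * sin x - p t * sin (y - x) * cos y = - (p t * cos (y - x)) * sin y"
  proof -
    have "sin x = sin (y - (y - x))" by simp
    also have "\<dots> = sin y * cos (y - x) - cos y * sin (y - x)" by (rule sin_diff)
    finally have *: "sin x = sin y * cos (y - x) - cos y * sin (y - x)" .
    show ?thesis by (subst *) (simp add: algebra_simps)
  qed
  finally have "iterate d (rot_row d \<theta>) (rot_label d \<theta>) id (Suc t) - ?w =
      plane_vec d (- p (Suc t) * cos y) (- p (Suc t) * sin y)"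
    unfolding pSuc .
  moreover have "iterate d (rot_row d \<theta>) (rot_label d \<theta>) id (Suc t) \<in> carrier_vec d"
    unfolding it using IH(1) X pinv_carrier[OF X]
    by (intro add_carrier_vec mult_mat_vec_carrier[of _ d 1] minus_carrier_vec) auto
  ultimately show ?case unfolding xy by blast
qed

text \<open>The residual on task \<open>t\<close> is the component of the final error along the
  normal of that row, whence the sine of the angle difference.\<close>

lemma forgetting_rot:
  assumes d: "d \<ge> 2" and "\<theta> 0 = 0"
  shows "forgetting d (rot_row d \<theta>) (rot_label d \<theta>) id k =
    (\<Prod>s<k. cos (\<theta> (Suc s) - \<theta> s))\<^sup>2 * (\<Sum>t\<in>{1..k}. (sin (\<theta> k - \<theta> t))\<^sup>2) / real k"
proof -
  let ?u = "iterate d (rot_row d \<theta>) (rot_label d \<theta>) id k"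
  let ?w = "plane_vec d 1 0"
  define p where "p = (\<Prod>s<k. cos (\<theta> (Suc s) - \<theta> s))"
  have u: "?u \<in> carrier_vec d" "?u - ?w = plane_vec d (- p * cos (\<theta> k)) (- p * sin (\<theta> k))"
    using iterate_rot[of d \<theta> k] assms unfolding p_def by blast+
  have "(vnorm (rot_row d \<theta> t *\<^sub>v ?u - rot_label d \<theta> t))\<^sup>2 = p\<^sup>2 * (sin (\<theta> k - \<theta> t))\<^sup>2" for t
  proof -
    let ?v = "plane_vec d (- sin (\<theta> t)) (cos (\<theta> t))"
    have "rot_row d \<theta> t *\<^sub>v ?u - rot_label d \<theta> t = rot_row d \<theta> t *\<^sub>v (?u - ?w)"
      using mult_minus_distrib_mat_vec[OF rot_row_carrier u(1), of ?w] by (simp add: rot_label_def)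
    also have "\<dots> = vec 1 (\<lambda>_. ?v \<bullet> (?u - ?w))"
      unfolding rot_row_def[of d \<theta> t] mult_mat_of_row ..
    also have "?v \<bullet> (?u - ?w) = - p * sin (\<theta> k - \<theta> t)"
      unfolding u(2) plane_vec_scalar_prod[OF d] sin_diff by (simp add: algebra_simps)
    finally have res: "rot_row d \<theta> t *\<^sub>v ?u - rot_label d \<theta> t = vec 1 (\<lambda>_. - p * sin (\<theta> k - \<theta> t))" .
    show ?thesis unfolding res vnorm_vec_1 by (simp add: power_mult_distrib)
  qed
  then show ?thesis unfolding forgetting_def p_def by (simp flip: sum_distrib_left)
qed

text \<open>
  Truncated subtraction keeps the angle at \<open>0\<close> for the first \<open>k - m\<close> tasks.
\<close>

lemma forgetting_rot_ge:
  assumes d: "d \<ge> 2" and m: "1 \<le> m" "m \<le> k"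
  defines "\<theta> \<equiv> \<lambda>t. real (t - (k - m)) * (pi / (2 * real m))"
  shows "1 - forgetting d (rot_row d \<theta>) (rot_label d \<theta>) id k \<le> real m / real k + 4 / real m"
proof -
  define x where "x = pi / (2 * real m)"
  \<comment> \<open>The gaps are 0 during the first \<open>k - m\<close> steps, giving factors 1,
    and \<open>x\<close> afterwards.\<close>
  have "(\<Prod>s<t. cos (\<theta> (Suc s) - \<theta> s)) = cos x ^ (t - (k - m))" for t
  proof (induction t)
    case (Suc t)
    show ?case
    proof (cases "t < k - m")
      case True
      then show ?thesis using Suc by (simp add: \<theta>_def)
    next
      case False
      then have "Suc t - (k - m) = Suc (t - (k - m))" by simp
      moreover from this have "\<theta> (Suc t) - \<theta> t = x"
        unfolding \<theta>_def x_def[symmetric] by (simp add: distrib_right)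
      ultimately show ?thesis using Suc by simp
    qed
  qed simp
  then have p: "(\<Prod>s<k. cos (\<theta> (Suc s) - \<theta> s)) = cos x ^ m" using m by simp
  have \<theta>k: "\<theta> k = pi / 2" using m by (simp add: \<theta>_def)
  \<comment> \<open>The first \<open>k - m\<close> tasks have angle 0, so each contributes
    \<open>sin (pi / 2) = 1\<close> squared; the other squares are dropped as nonnegative.\<close>
  have "real (k - m) = (\<Sum>t\<in>{1..k - m}. (sin (\<theta> k - \<theta> t))\<^sup>2)" unfolding \<theta>k by (simp add: \<theta>_def)
  also have "\<dots> \<le> (\<Sum>t\<in>{1..k}. (sin (\<theta> k - \<theta> t))\<^sup>2)" by (rule sum_mono2) auto
  finally have S: "real k - real m \<le> (\<Sum>t\<in>{1..k}. (sin (\<theta> k - \<theta> t))\<^sup>2)" using m by simp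
  have "(sin x)\<^sup>2 \<le> x\<^sup>2" using abs_sin_x_le_abs_x[of x] by (simp add: abs_le_square_iff)
  moreover have "(cos x)\<^sup>2 = 1 + - (sin x)\<^sup>2" by (simp add: cos_squared_eq)
  moreover have "(sin x)\<^sup>2 \<le> 1" by (simp add: abs_square_le_1)
  \<comment> \<open>Bernoulli's inequality for \<open>1 - (sin x)\<^sup>2\<close>, followed by
    \<open>(sin x)\<^sup>2 \<le> x\<^sup>2\<close>.\<close>
  ultimately have "1 - real m * x\<^sup>2 \<le> ((cos x)\<^sup>2) ^ m"
    using Bernoulli_inequality[of "- (sin x)\<^sup>2" m] mult_left_mono[of "(sin x)\<^sup>2" "x\<^sup>2" "real m"] by simp
  moreover have "real m * x\<^sup>2 \<le> 4 / real m"
  proof -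
    \<comment> \<open>\<open>real m * x\<^sup>2\<close> is \<open>pi\<^sup>2 / (4 * real m)\<close>,
      so \<open>pi < 4\<close> yields the constant 4.\<close>
    have "pi\<^sup>2 \<le> 4\<^sup>2" using pi_less_4 by (intro power_mono) auto
    then show ?thesis using m by (simp add: x_def field_simps power2_eq_square)
  qed
  moreover have "((cos x)\<^sup>2) ^ m = (cos x ^ m)\<^sup>2" by (simp add: power_mult[symmetric] mult.commute)
  ultimately have c: "1 - 4 / real m \<le> (cos x ^ m)\<^sup>2" by simp
  \<comment> \<open>The right side exceeds the left by the product of the two deficits.\<close>
  have "1 - (real m / real k + 4 / real m) \<le> (1 - real m / real k) * (1 - 4 / real m)"
  proof -
    have "(1 - a) * (1 - b) = 1 - (a + b) + a * b" for a b :: real by (simp add: algebra_simps)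
    then show ?thesis by simp
  qed
  also have "\<dots> \<le> (1 - real m / real k) * (cos x ^ m)\<^sup>2"
    using c m by (intro mult_left_mono) simp_all
  also have "\<dots> = (cos x ^ m)\<^sup>2 * (real k - real m) / real k" using m by (simp add: field_simps)
  also have "\<dots> \<le> (cos x ^ m)\<^sup>2 * (\<Sum>t\<in>{1..k}. (sin (\<theta> k - \<theta> t))\<^sup>2) / real k"
    using S by (intro divide_right_mono mult_left_mono) simp_all
  also have "\<dots> = forgetting d (rot_row d \<theta>) (rot_label d \<theta>) id k"
    using forgetting_rot[OF d, of \<theta> k] p by (simp add: \<theta>_def)
  finally show ?thesis by simp
qed

text \<open>Taking \<open>m\<close> as \<open>sqrt (real k)\<close> rounded up balances the
  deficits. Rounding at most doubles it, so they are at most \<open>2 / sqrt (real k)\<close> and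
  \<open>4 / sqrt (real k)\<close>.\<close>

lemma high_forgetting_collection:
  assumes d: "d \<ge> 2" and k: "k \<ge> 1"
  shows "\<exists>Xs ys. valid_collection d k Xs ys \<and> 1 - forgetting d Xs ys id k \<le> 6 / sqrt (real k)"
proof -
  define m where "m = nat \<lceil>sqrt (real k)\<rceil>"
  have s1: "1 \<le> sqrt (real k)" using k by simp
  have "sqrt (real k) * 1 \<le> sqrt (real k) * sqrt (real k)" using s1 by (intro mult_left_mono) simp_all
  then have "sqrt (real k) \<le> real k" by simp
  then have mk: "m \<le> k" unfolding m_def by (simp add: ceiling_le_iff nat_le_iff)
  have ms: "sqrt (real k) \<le> real m" unfolding m_def by (rule real_nat_ceiling_ge)
  have m2: "real m \<le> 2 * sqrt (real k)" unfolding m_def using s1 by linarith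
  have m1: "1 \<le> m" using ms s1 by linarith
  have "real m / real k \<le> 2 * sqrt (real k) / real k" using m2 by (intro divide_right_mono) simp_all
  also have "\<dots> = 2 / sqrt (real k)" using k by (simp add: field_simps)
  finally have "real m / real k \<le> 2 / sqrt (real k)" .
  moreover have "4 / real m \<le> 4 / sqrt (real k)" using ms k by (intro frac_le) simp_all
  ultimately have "real m / real k + 4 / real m \<le> 6 / sqrt (real k)" by simp
  then show ?thesis
    using forgetting_rot_ge[OF d m1 mk] valid_collection_rot[OF d] by (meson order_trans)
qed

theorem mainTheorem2:
  shows "(\<exists>C>0. \<forall>d\<ge>2. \<forall>k\<ge>2.
            1 - Sup {forgetting d Xs ys id k | Xs ys. valid_collection d k Xs ys}
              \<le> C / sqrt (real k))
       \<and> (\<exists>C'>0. \<forall>d\<ge>2. \<forall>\<epsilon>::real. 0 < \<epsilon> \<and> \<epsilon> < 1 \<longrightarrow>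
            (\<exists>k Xs ys. k \<ge> 1 \<and> real k \<le> C' / \<epsilon>\<^sup>2 \<and> valid_collection d k Xs ys \<and>
                       forgetting d Xs ys id k > 1 - \<epsilon>))"
\<comment> \<open>One constant serves both parts: it exceeds the 6 of the rate, and it is 49 plus 1
  for rounding \<open>k\<close> up.\<close>
proof (rule conjI; (rule exI[of _ 50], intro conjI allI impI))
  fix d k :: nat
  assume d: "2 \<le> d" and k: "2 \<le> k"
  then obtain Xs ys where S: "valid_collection d k Xs ys" "1 - forgetting d Xs ys id k \<le> 6 / sqrt (real k)"
    using high_forgetting_collection[of d k] by auto
  \<comment> \<open>Boundedness lets a single collection bound the \<open>Sup\<close> from
    below.\<close>
  have "bdd_above {forgetting d Xs ys id k | Xs ys. valid_collection d k Xs ys}"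
    by (rule bdd_aboveI[of _ 1]) (auto intro: forgetting_le_1)
  then have "forgetting d Xs ys id k \<le> Sup {forgetting d Xs ys id k | Xs ys. valid_collection d k Xs ys}"
    using S(1) by (intro cSup_upper) auto
  moreover have "6 / sqrt (real k) \<le> 50 / sqrt (real k)" by (simp add: divide_right_mono)
  ultimately show "1 - Sup {forgetting d Xs ys id k | Xs ys. valid_collection d k Xs ys} \<le> 50 / sqrt (real k)"
    using S(2) by linarith
next
  fix d :: nat and \<epsilon> :: real
  assume d: "2 \<le> d" and e: "0 < \<epsilon> \<and> \<epsilon> < 1"
  \<comment> \<open>\<open>49 = 7\<^sup>2\<close> makes \<open>6 / sqrt (real k)\<close> at most
    \<open>6 * \<epsilon> / 7\<close>, strictly below \<open>\<epsilon>\<close>.\<close>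
  define k where "k = nat \<lceil>49 / \<epsilon>\<^sup>2\<rceil>"
  have e1: "1 \<le> 1 / \<epsilon>\<^sup>2" using e by (simp add: power_le_one)
  have k_ge: "49 / \<epsilon>\<^sup>2 \<le> real k" unfolding k_def by (rule real_nat_ceiling_ge)
  then have k1: "1 \<le> k" using e1 by linarith
  have "real k \<le> 49 / \<epsilon>\<^sup>2 + 1" unfolding k_def using e1 by linarith
  then have k_le: "real k \<le> 50 / \<epsilon>\<^sup>2" using e1 by linarith
  have "7 / \<epsilon> = sqrt (49 / \<epsilon>\<^sup>2)"
    using e by (intro real_sqrt_unique[symmetric]) (simp_all add: power_divide)
  also have "\<dots> \<le> sqrt (real k)" using k_ge by simp
  finally have "6 / sqrt (real k) \<le> 6 / (7 / \<epsilon>)"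
    using e by (intro frac_le) simp_all
  also have "\<dots> < \<epsilon>" using e by simp
  finally have small: "6 / sqrt (real k) < \<epsilon>" .
  obtain Xs ys where S: "valid_collection d k Xs ys" "1 - forgetting d Xs ys id k \<le> 6 / sqrt (real k)"
    using high_forgetting_collection[OF d k1] by auto
  have "forgetting d Xs ys id k > 1 - \<epsilon>" using S(2) small by linarith
  then show "\<exists>k Xs ys. k \<ge> 1 \<and> real k \<le> 50 / \<epsilon>\<^sup>2 \<and> valid_collection d k Xs ys \<and>
      forgetting d Xs ys id k > 1 - \<epsilon>"
    using k1 k_le S(1) by blast
qed simp_all

end
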